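(* Let $H\in C^2(\mathbb{R}^4)$ and $E\in\mathbb{R}$. Fix an interior base point $b$ (a point of the interior of the admissible region $A_E$) near the discriminant $D_E$ and set $\Delta=E-\mathcal{E}(b)>0$. Let $p_1^c=m(b)$ be the minimizer of $h_b$, let $p_1^-<p_1^+$ be the two lifts of $b$, i.e. the two roots of $h_b(p_1)=E$, and let $F_b(p_1)=(h_b(p_1)-E)^2$ be the residual. Under the coercivity condition (C), the unimodality condition (U), and the nondegeneracy condition (N) at the fibrewise minimum, the two lifts and the residual satisfy, as $\Delta\to0^+$, $$p_1^\pm-p_1^c=\pm\sqrt{\frac{2\Delta}{h_b''(p_1^c)}}+O(\Delta),\qquad h_b'(p_1^\pm)=\pm\sqrt{2\,h_b''(p_1^c)\,\Delta}+O(\Delta),$$ $$F_b''(p_1^\pm)=2\,h_b'(p_1^\pm)^2=4h_b''(p_1^c)\,\Delta+O(\Delta^{3/2}).$$ Thus the root separation scales as $\Delta^{1/2}$ while the residual curvature at either minimizer of $F_b$ scales as $\Delta$.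
   Context: Coordinates on $\mathbb{R}^4$ are $(q_1,q_2,p_1,p_2)$. For $b=(q_2,p_2)\in\mathbb{R}^2$, $h_b(p_1)=H(0,q_2,p_1,p_2)$ and $\mathcal{E}(b)=\inf_{p_1\in\mathbb{R}}h_b(p_1)$. The admissible region is $A_E=\{b\in\mathbb{R}^2:\exists\,p_1\in\mathbb{R},\ h_b(p_1)=E\}$ and the discriminant is $D_E=\{b\in\mathbb{R}^2:\exists\,p_1\in\mathbb{R},\ h_b(p_1)=E,\ h_b'(p_1)=0\}$. Condition (C): $h_b(p_1)\to+\infty$ as $|p_1|\to\infty$, locally uniformly in $b$. Condition (U): for every $b$, $h_b\in C^1$ and there is a unique $m(b)\in\mathbb{R}$ with $h_b'<0$ on $(-\infty,m(b))$ and $h_b'>0$ on $(m(b),\infty)$. Under (C) and (U), $h_b(p_1)=E$ has exactly two roots when $\mathcal{E}(b)<E$, and these are the two global minimizers of $F_b$. Condition (N) at the fibrewise minimum: $\partial^2_{p_1p_1}H\neq0$ at the point $(0,q_2,p_1^c,p_2)$, i.e. $h_b''(p_1^c)\ne0$.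
   Formalization: For H only C² the stated O-remainders fail (e.g. p₁²+|p₁|^{5/2}); here C² gives remainders o(Δ^{1/2}), o(Δ^{1/2}), o(Δ) and both scalings, and O(Δ), O(Δ), O(Δ^{3/2}) are proved if h_b'' is Lipschitz at the minimizer uniformly for nearby b (true for C³). *)

theory Defs
  imports "HOL-Analysis.Analysis" "HOL-Library.Landau_Symbols"
begin

text \<open>
  Points of \<open>\<real>\<^sup>4\<close> are tuples \<open>(q\<^sub>1, q\<^sub>2, p\<^sub>1, p\<^sub>2)\<close> and base points are pairs
  \<open>b = (q\<^sub>2, p\<^sub>2)\<close>.  The product types carry the Euclidean norm.
\<close>

definition C2 :: "('a::real_normed_vector \<Rightarrow> 'b::real_normed_vector) \<Rightarrow> bool" where
  "C2 f \<longleftrightarrow> (\<exists>f' :: 'a \<Rightarrow> 'a \<Rightarrow>\<^sub>L 'b. \<exists>f'' :: 'a \<Rightarrow> 'a \<Rightarrow>\<^sub>L 'a \<Rightarrow>\<^sub>L 'b.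
     (\<forall>x. (f has_derivative blinfun_apply (f' x)) (at x)) \<and>
     (\<forall>x. (f' has_derivative blinfun_apply (f'' x)) (at x)) \<and>
     continuous_on UNIV f'')"

definition fibre :: "(real \<times> real \<times> real \<times> real \<Rightarrow> real) \<Rightarrow> real \<times> real \<Rightarrow> real \<Rightarrow> real" where
  "fibre H b p = H (0, fst b, p, snd b)"

definition fibre_inf :: "(real \<times> real \<times> real \<times> real \<Rightarrow> real) \<Rightarrow> real \<times> real \<Rightarrow> real" where
  "fibre_inf H b = (INF p. fibre H b p)"

definition admissible :: "(real \<times> real \<times> real \<times> real \<Rightarrow> real) \<Rightarrow> real \<Rightarrow> (real \<times> real) set" where
  "admissible H E = {b. \<exists>p. fibre H b p = E}"

definition discriminant :: "(real \<times> real \<times> real \<times> real \<Rightarrow> real) \<Rightarrow> real \<Rightarrow> (real \<times> real) set" where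
  "discriminant H E = {b. \<exists>p. fibre H b p = E \<and> (fibre H b has_real_derivative 0) (at p)}"

definition coercive :: "(real \<times> real \<times> real \<times> real \<Rightarrow> real) \<Rightarrow> bool" where
  "coercive H \<longleftrightarrow> (\<forall>b\<^sub>0. \<exists>U. open U \<and> b\<^sub>0 \<in> U \<and>
     (\<forall>M. \<exists>R. \<forall>b\<in>U. \<forall>p. R \<le> \<bar>p\<bar> \<longrightarrow> M \<le> fibre H b p))"

definition is_turning_point :: "(real \<Rightarrow> real) \<Rightarrow> real \<Rightarrow> bool" where
  "is_turning_point h m \<longleftrightarrow> (\<forall>p<m. deriv h p < 0) \<and> (\<forall>p>m. deriv h p > 0)"

definition unimodal :: "(real \<times> real \<times> real \<times> real \<Rightarrow> real) \<Rightarrow> bool" where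
  "unimodal H \<longleftrightarrow>
     (\<forall>b. fibre H b C1_differentiable_on UNIV \<and> (\<exists>!m. is_turning_point (fibre H b) m))"

definition fibre_argmin :: "(real \<times> real \<times> real \<times> real \<Rightarrow> real) \<Rightarrow> real \<times> real \<Rightarrow> real" where
  "fibre_argmin H b = (THE m. is_turning_point (fibre H b) m)"

definition min_curvature :: "(real \<times> real \<times> real \<times> real \<Rightarrow> real) \<Rightarrow> real \<times> real \<Rightarrow> real" where
  "min_curvature H b = deriv (deriv (fibre H b)) (fibre_argmin H b)"

definition nondegenerate_min :: "(real \<times> real \<times> real \<times> real \<Rightarrow> real) \<Rightarrow> real \<times> real \<Rightarrow> bool" where
  "nondegenerate_min H b \<longleftrightarrow> min_curvature H b \<noteq> 0"

text \<open>
  \<open>Min\<close> and \<open>Max\<close> are meaningful here when the root set is finite and nonempty.  For coercive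
  unimodal \<open>H\<close> and \<open>fibre_inf H b < E\<close> it has exactly two elements.
\<close>

definition lift_minus :: "(real \<times> real \<times> real \<times> real \<Rightarrow> real) \<Rightarrow> real \<Rightarrow> real \<times> real \<Rightarrow> real" where
  "lift_minus H E b = Min {p. fibre H b p = E}"

definition lift_plus :: "(real \<times> real \<times> real \<times> real \<Rightarrow> real) \<Rightarrow> real \<Rightarrow> real \<times> real \<Rightarrow> real" where
  "lift_plus H E b = Max {p. fibre H b p = E}"

definition residual ::
  "(real \<times> real \<times> real \<times> real \<Rightarrow> real) \<Rightarrow> real \<Rightarrow> real \<times> real \<Rightarrow> real \<Rightarrow> real" where
  "residual H E b p = (fibre H b p - E)\<^sup>2"

definition gap :: "(real \<times> real \<times> real \<times> real \<Rightarrow> real) \<Rightarrow> real \<Rightarrow> real \<times> real \<Rightarrow> real" where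
  "gap H E b = E - fibre_inf H b"

text \<open>
  The regime \<open>\<Delta> \<rightarrow> 0+\<close> near a discriminant point \<open>b\<^sub>0\<close> of level \<open>E\<^sub>0\<close>: the level \<open>E\<close> tends to
  \<open>E\<^sub>0\<close> and \<open>b\<close> tends to \<open>b\<^sub>0\<close> through interior points of the admissible region of level \<open>E\<close>
  with \<open>\<Delta> = gap H E b > 0\<close>.  This contains both the regime where \<open>b = b\<^sub>0\<close> is fixed and \<open>E\<close>
  decreases to \<open>fibre_inf H b\<^sub>0\<close>, and the regime where \<open>E = E\<^sub>0\<close> is fixed and \<open>b\<close> approaches the
  discriminant.  Landau symbols along this filter have constants uniform in \<open>(E, b)\<close>.
\<close>

definition near_discriminant ::
  "(real \<times> real \<times> real \<times> real \<Rightarrow> real) \<Rightarrow> real \<Rightarrow> real \<times> real \<Rightarrow> (real \<times> real \<times> real) filter" where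
  "near_discriminant H E\<^sub>0 b\<^sub>0 =
     (at (E\<^sub>0, b\<^sub>0) within {(E, b). b \<in> interior (admissible H E) \<and> gap H E b > 0})"

text \<open>
  Twice continuous differentiability yields only little-o remainders in the expansion of the lifts:
  \<open>H (q\<^sub>1, q\<^sub>2, p\<^sub>1, p\<^sub>2) = p\<^sub>1\<^sup>2 + \<bar>p\<^sub>1\<bar> powr (5/2)\<close> has \<open>p\<^sub>1\<^sup>+ = \<Delta> powr (1/2) - 1/2 * \<Delta> powr (3/4) + \<dots>\<close>.
  The remainders \<open>O(\<Delta>)\<close> and \<open>O(\<Delta> powr (3/2))\<close> come from a third-order Taylor estimate, for which
  the following bound suffices.  It holds whenever \<open>H\<close> is three times continuously differentiable,
  coercive and unimodal, and the minimum at \<open>b\<^sub>0\<close> is nondegenerate.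
\<close>

definition lipschitz_curvature :: "(real \<times> real \<times> real \<times> real \<Rightarrow> real) \<Rightarrow> real \<times> real \<Rightarrow> bool" where
  "lipschitz_curvature H b\<^sub>0 \<longleftrightarrow>
     (\<exists>L. \<forall>\<^sub>F (b, p) in nhds (b\<^sub>0, fibre_argmin H b\<^sub>0).
        \<bar>deriv (deriv (fibre H b)) p - min_curvature H b\<bar> \<le> L * \<bar>p - fibre_argmin H b\<bar>)"

end

theory Submission
  imports Defs
begin

text \<open>
  Put \<open>k = h\<^sub>b''(m)\<close> at the fibrewise minimum \<open>m\<close> and \<open>x = \<bar>p - m\<bar>\<close> for a lift \<open>p\<close>, and let \<open>w\<close>
  bound \<open>\<bar>h\<^sub>b'' - k\<bar>\<close> between \<open>m\<close> and \<open>p\<close>.  Taylor's formula at \<open>m\<close> gives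
  \<open>2 \<Delta> = h\<^sub>b''(u) x\<^sup>2\<close> and \<open>\<bar>h\<^sub>b'(p)\<bar> = h\<^sub>b''(v) x\<close> with \<open>u\<close>, \<open>v\<close> in between, so the errors in the
  separation and the slope are of order \<open>w x\<close> and the error in the curvature is of order \<open>w x\<^sup>2\<close>,
  while \<open>x\<close> is comparable to \<open>sqrt \<Delta>\<close>.  Near the discriminant point the minimizer and both
  lifts converge to the minimizer over \<open>b\<^sub>0\<close>, by strict monotonicity of \<open>h\<^sub>b\<close> on each side of \<open>m\<close>.
  Hence \<open>w\<close> can be taken arbitrarily small, uniformly in \<open>(E, b)\<close>, and if the curvature is
  Lipschitz then \<open>w\<close> can be taken of order \<open>x\<close>.
\<close>

section \<open>Regularity of the fibre functions in the momentum and the base point\<close>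

text \<open>The fibre is \<open>H\<close> along an affine line with direction \<open>e\<close>, so
  its derivatives are directional derivatives of \<open>H\<close> along \<open>e\<close>. Joint
  continuity in \<open>(b, p)\<close> is what later permits limits in which base point and momentum
  move together.\<close>

lemma fibre_C2:
  assumes "C2 H"
  obtains G K where
    "\<And>b p. (fibre H b has_real_derivative G b p) (at p)"
    "\<And>b p. (G b has_real_derivative K b p) (at p)"
    "continuous_on UNIV (\<lambda>(b, p). fibre H b p)"
    "continuous_on UNIV (\<lambda>(b, p). G b p)"
    "continuous_on UNIV (\<lambda>(b, p). K b p)"
proof -
  obtain f' :: "real \<times> real \<times> real \<times> real \<Rightarrow> (real \<times> real \<times> real \<times> real) \<Rightarrow>\<^sub>L real"
    and f'' :: "real \<times> real \<times> real \<times> real \<Rightarrow> (real \<times> real \<times> real \<times> real) \<Rightarrow>\<^sub>L (real \<times> real \<times> real \<times> real) \<Rightarrow>\<^sub>L real"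
    where f': "\<And>x. (H has_derivative blinfun_apply (f' x)) (at x)"
      and f'': "\<And>x. (f' has_derivative blinfun_apply (f'' x)) (at x)"
      and cont: "continuous_on UNIV f''"
    using assms unfolding C2_def by blast
  define e :: "real \<times> real \<times> real \<times> real" where "e = (0, 0, 1, 0)"
  define pt :: "real \<times> real \<Rightarrow> real \<Rightarrow> real \<times> real \<times> real \<times> real" where "pt b p = (0, fst b, p, snd b)" for b p
  define G where "G b p = blinfun_apply (f' (pt b p)) e" for b p
  define K where "K b p = blinfun_apply (blinfun_apply (f'' (pt b p)) e) e" for b p
  \<comment> \<open>An increment as a multiple of the fixed vector \<open>e\<close> lets linearity
    pull the scalar out of both derivatives.\<close>
  have scaled: "(0, 0, t, 0) = t *\<^sub>R e" for t :: real
    by (simp add: e_def)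
  have pt: "(pt b has_derivative (\<lambda>t. t *\<^sub>R e)) (at p)" for b p
    unfolding pt_def scaled[symmetric] by (auto intro!: derivative_eq_intros)
  have contpt: "continuous_on UNIV (\<lambda>(b, p). pt b p)"
    unfolding pt_def case_prod_beta by (intro continuous_intros)
  have "(fibre H b has_real_derivative G b p) (at p)" for b p
  proof -
    have "((\<lambda>p. H (pt b p)) has_derivative (\<lambda>t. f' (pt b p) (t *\<^sub>R e))) (at p)"
      by (rule has_derivative_compose[OF pt f'])
    then show ?thesis
      unfolding has_field_derivative_def G_def fibre_def[abs_def] pt_def
      by (simp add: blinfun.scaleR_right mult_commute_abs)
  qed
  moreover have "(G b has_real_derivative K b p) (at p)" for b p
  proof -
    have "((\<lambda>p. f' (pt b p)) has_derivative (\<lambda>t. f'' (pt b p) (t *\<^sub>R e))) (at p)"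
      by (rule has_derivative_compose[OF pt f''])
    \<comment> \<open>Evaluation of a bounded operator at the fixed vector \<open>e\<close> is
      linear, so it commutes with differentiation.\<close>
    then have "((\<lambda>p. f' (pt b p) e) has_derivative (\<lambda>t. f'' (pt b p) (t *\<^sub>R e) e)) (at p)"
      by (auto intro!: derivative_eq_intros)
    then show ?thesis
      unfolding has_field_derivative_def K_def G_def[abs_def]
      by (simp add: blinfun.scaleR_right blinfun.scaleR_left mult_commute_abs)
  qed
  moreover have "continuous_on UNIV (\<lambda>(b, p). fibre H b p)"
  proof -
    have "continuous_on UNIV H"
      using f' by (intro continuous_at_imp_continuous_on ballI has_derivative_continuous)
    from continuous_on_compose2[OF this contpt] show ?thesis
      by (simp add: fibre_def pt_def case_prod_beta)
  qed
  moreover have "continuous_on UNIV (\<lambda>(b, p). G b p)"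
  proof -
    have "continuous_on UNIV f'"
      using f'' by (intro continuous_at_imp_continuous_on ballI has_derivative_continuous)
    from continuous_on_compose2[OF this contpt]
    have "continuous_on UNIV (\<lambda>z. f' (pt (fst z) (snd z)))"
      by (simp add: case_prod_beta)
    then show ?thesis
      unfolding G_def case_prod_beta by (intro continuous_intros)
  qed
  moreover have "continuous_on UNIV (\<lambda>(b, p). K b p)"
  proof -
    from continuous_on_compose2[OF cont contpt]
    have "continuous_on UNIV (\<lambda>z. f'' (pt (fst z) (snd z)))"
      by (simp add: case_prod_beta)
    then show ?thesis
      unfolding K_def case_prod_beta by (intro continuous_intros)
  qed
  ultimately show thesis
    by (rule that)
qed

section \<open>Taylor estimates for one side of a quadratic well\<close>

text \<open>Model case of a single lift: the minimizer sits at 0 and the lift at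
  \<open>x > 0\<close>. The ceiling \<open>k / 2\<close> on \<open>w\<close> keeps the curvature
  comparable to \<open>k\<close> along the whole segment.\<close>

lemma quadratic_level_estimates:
  fixes g g' g'' :: "real \<Rightarrow> real"
  assumes "x > 0" "k > 0" "0 \<le> w" "w \<le> k / 2"
    and g: "\<And>t. (g has_real_derivative g' t) (at t)"
    and g': "\<And>t. (g' has_real_derivative g'' t) (at t)"
    and "g' 0 = 0" and D: "g x - g 0 = D"
    and near: "\<And>t. 0 \<le> t \<Longrightarrow> t \<le> x \<Longrightarrow> \<bar>g'' t - k\<bar> \<le> w"
  shows "k / 4 * x\<^sup>2 \<le> D" and "D \<le> k * x\<^sup>2"
    and "\<bar>x - sqrt (2 * D / k)\<bar> \<le> w * x / k"
    and "\<bar>g' x - sqrt (2 * k * D)\<bar> \<le> 2 * w * x"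
    and "\<bar>2 * (g' x)\<^sup>2 - 4 * k * D\<bar> \<le> 16 * k * w * x\<^sup>2"
proof -
  \<comment> \<open>\<open>diff\<close> lists the derivatives in the form the Maclaurin expansion
    expects; at order 2 the linear term drops because \<open>g' 0 = 0\<close>.\<close>
  define diff where "diff = (\<lambda>i::nat. if i = 0 then g else if i = 1 then g' else g'')"
  have "\<exists>t. 0 < t \<and> t < x \<and> g x = (\<Sum>i<2. diff i 0 / fact i * x ^ i) + diff 2 t / fact 2 * x ^ 2"
    by (rule Maclaurin) (use assms in \<open>auto simp: diff_def less_2_cases_iff\<close>)
  then obtain u where u: "0 < u" "u < x" and "g x = g 0 + g'' u / 2 * x\<^sup>2"
    by (auto simp: diff_def eval_nat_numeral \<open>g' 0 = 0\<close>)
  with D have Du: "2 * D = g'' u * x\<^sup>2"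
    by simp
  obtain v where v: "0 < v" "v < x" and "g' x - g' 0 = (x - 0) * g'' v"
    using MVT2[OF \<open>x > 0\<close>, of g' g''] g' by blast
  then have slope: "g' x = g'' v * x"
    by (simp add: \<open>g' 0 = 0\<close>)
  have nu: "\<bar>g'' u - k\<bar> \<le> w" and nv: "\<bar>g'' v - k\<bar> \<le> w"
    using near u v by simp_all
  have x2: "0 \<le> x\<^sup>2"
    by simp
  \<comment> \<open>The value lies in [k/2, 3k/2]; the upper end is relaxed to \<open>2 * k\<close>
    so that halving gives the bound \<open>k * x\<^sup>2\<close>.\<close>
  have "k / 2 \<le> g'' u" "g'' u \<le> 2 * k"
    using nu \<open>w \<le> k / 2\<close> \<open>k > 0\<close> by linarith+
  then have "k / 2 * x\<^sup>2 \<le> g'' u * x\<^sup>2" "g'' u * x\<^sup>2 \<le> 2 * k * x\<^sup>2"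
    using x2 by (simp_all only: mult_right_mono)
  with Du show Dlo: "k / 4 * x\<^sup>2 \<le> D" and Dhi: "D \<le> k * x\<^sup>2"
    by simp_all
  \<comment> \<open>\<open>s\<close> is the separation that a purely quadratic well would have,
    characterised by \<open>k * s\<^sup>2 = 2 * D\<close>.\<close>
  define s where "s = sqrt (2 * D / k)"
  have "0 \<le> k / 4 * x\<^sup>2"
    using \<open>k > 0\<close> by simp
  then have "D \<ge> 0"
    using Dlo by linarith
  then have s: "s \<ge> 0" and ks2: "k * s\<^sup>2 = 2 * D"
    using \<open>k > 0\<close> by (simp_all add: s_def)
  \<comment> \<open>The Taylor remainder controls the difference of the squares of \<open>x\<close>
    and \<open>s\<close>. Replacing the factor \<open>x + s\<close> by the smaller \<open>x\<close>
    allows one power of \<open>x\<close> to be cancelled.\<close>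
  have "k * \<bar>x - s\<bar> * x \<le> k * \<bar>x - s\<bar> * (x + s)"
    using s \<open>k > 0\<close> by (intro mult_left_mono) auto
  also have "\<dots> = \<bar>k * x\<^sup>2 - k * s\<^sup>2\<bar>"
  proof -
    have "k * x\<^sup>2 - k * s\<^sup>2 = k * (x - s) * (x + s)"
      by (simp add: power2_eq_square algebra_simps)
    then show ?thesis
      using s \<open>x > 0\<close> \<open>k > 0\<close> by (simp add: abs_mult)
  qed
  also have "\<dots> = \<bar>g'' u - k\<bar> * x\<^sup>2"
  proof -
    have "k * x\<^sup>2 - k * s\<^sup>2 = - ((g'' u - k) * x\<^sup>2)"
      unfolding ks2 Du by (simp add: algebra_simps)
    then show ?thesis
      by (simp only: abs_minus abs_mult) simp
  qed
  also have "\<dots> \<le> w * x\<^sup>2"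
    using nu x2 by (rule mult_right_mono)
  finally have "(k * \<bar>x - s\<bar>) * x \<le> (w * x) * x"
    by (simp add: power2_eq_square)
  then have kxs: "k * \<bar>x - s\<bar> \<le> w * x"
    using \<open>x > 0\<close> by simp
  then show "\<bar>x - sqrt (2 * D / k)\<bar> \<le> w * x / k"
    using \<open>k > 0\<close> by (simp add: s_def field_simps)
  have ks: "sqrt (2 * k * D) = k * s"
  proof (rule real_sqrt_unique)
    show "(k * s)\<^sup>2 = 2 * k * D"
      using ks2 by (simp add: power2_eq_square mult.assoc mult.left_commute)
  qed (use s \<open>k > 0\<close> in simp)
  \<comment> \<open>The slope error splits into the deviation of the curvature at \<open>v\<close>
    and \<open>k\<close> times the separation error; each contributes \<open>w * x\<close>.\<close>
  have "g' x - k * s = (g'' v - k) * x + k * (x - s)"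
    by (simp add: slope algebra_simps)
  then have "\<bar>g' x - k * s\<bar> \<le> \<bar>g'' v - k\<bar> * x + k * \<bar>x - s\<bar>"
    using abs_triangle_ineq[of "(g'' v - k) * x" "k * (x - s)"] \<open>x > 0\<close> \<open>k > 0\<close>
    by (simp add: abs_mult)
  also have "\<dots> \<le> w * x + w * x"
    using nv kxs \<open>x > 0\<close> by (intro add_mono mult_right_mono) auto
  finally have slope_err: "\<bar>g' x - k * s\<bar> \<le> 2 * w * x"
    by simp
  then show "\<bar>g' x - sqrt (2 * k * D)\<bar> \<le> 2 * w * x"
    by (simp add: ks)
  have wx: "w * x \<le> k / 2 * x"
    using \<open>w \<le> k / 2\<close> \<open>x > 0\<close> by (intro mult_right_mono) auto
  have "k * s = k * x - k * (x - s)"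
    by (simp add: algebra_simps)
  moreover have "\<bar>k * (x - s)\<bar> = k * \<bar>x - s\<bar>"
    using \<open>k > 0\<close> by (simp add: abs_mult)
  ultimately have "k * s \<le> 3 / 2 * (k * x)"
    using kxs wx by linarith
  \<comment> \<open>The slope differs from \<open>k * s\<close> by at most \<open>k * x\<close>, and
    \<open>2 * (k * s)\<close> is at most \<open>3 * (k * x)\<close>; together they give the factor
    4.\<close>
  then have "\<bar>g' x + k * s\<bar> \<le> 4 * k * x"
    using slope_err wx s \<open>k > 0\<close> mult_nonneg_nonneg[of k s] by linarith
  then have "\<bar>g' x - k * s\<bar> * \<bar>g' x + k * s\<bar> \<le> (2 * w * x) * (4 * k * x)"
    using slope_err by (intro mult_mono) (use \<open>x > 0\<close> \<open>0 \<le> w\<close> in auto)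
  \<comment> \<open>Because \<open>4 * k * D = 2 * (k * s)\<^sup>2\<close>, the curvature error is
    twice a difference of squares.\<close>
  moreover have "2 * (g' x)\<^sup>2 - 4 * k * D = 2 * ((g' x - k * s) * (g' x + k * s))"
  proof -
    have "4 * k * D = 2 * k * (k * s\<^sup>2)"
      by (simp add: ks2)
    then show ?thesis
      by (simp only:) (simp add: power2_eq_square algebra_simps)
  qed
  ultimately show "\<bar>2 * (g' x)\<^sup>2 - 4 * k * D\<bar> \<le> 16 * k * w * x\<^sup>2"
    by (simp add: abs_mult power2_eq_square mult_ac)
qed

section \<open>Minimizer, lifts and residual of coercive unimodal fibres\<close>

lemma tendsto_case_prod_continuous:
  assumes "continuous_on UNIV (\<lambda>(b, p). f b p)" "(u \<longlongrightarrow> b) F" "(v \<longlongrightarrow> p) F"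
  shows "((\<lambda>x. f (u x) (v x)) \<longlongrightarrow> f b p) F"
  using continuous_on_tendsto_compose[OF assms(1) tendsto_Pair[OF assms(2,3)]] by simp

locale unimodal_fibres =
  fixes H :: "real \<times> real \<times> real \<times> real \<Rightarrow> real"
  assumes C2: "C2 H" and coercive: "coercive H" and unimodal: "unimodal H"
begin

abbreviation "h \<equiv> fibre H"
abbreviation "G b \<equiv> deriv (h b)"
abbreviation "K b \<equiv> deriv (deriv (h b))"
abbreviation "m \<equiv> fibre_argmin H"
abbreviation "k \<equiv> min_curvature H"

text \<open>Transfers the regularity to \<open>deriv\<close>, the form in which unimodality and
  curvature are defined.\<close>

lemma fibre_regularity:
  shows DERIV_h: "(h b has_real_derivative G b p) (at p)"
    and DERIV_G: "(G b has_real_derivative K b p) (at p)"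
    and continuous_h: "continuous_on UNIV (\<lambda>(b, p). h b p)"
    and continuous_G: "continuous_on UNIV (\<lambda>(b, p). G b p)"
    and continuous_K: "continuous_on UNIV (\<lambda>(b, p). K b p)"
proof -
  obtain G' K' where
    d1: "\<And>b p. (h b has_real_derivative G' b p) (at p)" and
    d2: "\<And>b p. (G' b has_real_derivative K' b p) (at p)" and
    c: "continuous_on UNIV (\<lambda>(b, p). h b p)" "continuous_on UNIV (\<lambda>(b, p). G' b p)"
      "continuous_on UNIV (\<lambda>(b, p). K' b p)"
    by (rule fibre_C2[OF C2]) blast
  have G: "deriv (h b) = G' b" for b
    using d1 by (intro ext DERIV_imp_deriv)
  have K: "deriv (deriv (h b)) = K' b" for b
    unfolding G using d2 by (intro ext DERIV_imp_deriv)
  show "(h b has_real_derivative G b p) (at p)" "(G b has_real_derivative K b p) (at p)"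
    "continuous_on UNIV (\<lambda>(b, p). h b p)" "continuous_on UNIV (\<lambda>(b, p). G b p)"
    "continuous_on UNIV (\<lambda>(b, p). K b p)"
    \<comment> \<open>Second derivatives are rewritten first; otherwise \<open>G\<close> would
      rewrite the inner \<open>deriv\<close> and hide the pattern of \<open>K\<close>.\<close>
    unfolding K unfolding G by (fact d1 d2 c)+
qed

lemma continuous_on_h: "continuous_on S (h b)"
  by (intro continuous_at_imp_continuous_on ballI DERIV_isCont[OF DERIV_h])

lemma turning_point: "is_turning_point (h b) (m b)"
proof -
  have "\<exists>!p. is_turning_point (h b) p"
    using unimodal unfolding unimodal_def by blast
  then show ?thesis
    unfolding fibre_argmin_def by (rule theI')
qed

lemma G_neg: "p < m b \<Longrightarrow> G b p < 0" and G_pos: "m b < p \<Longrightarrow> G b p > 0"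
  using turning_point[of b] by (auto simp: is_turning_point_def)

text \<open>Unimodality fixes the sign of the derivative only away from the minimizer; continuity
  passes to the limit from both sides.\<close>

lemma G_argmin: "G b (m b) = 0"
proof (rule antisym)
  have "G b \<midarrow>m b\<rightarrow> G b (m b)"
    using DERIV_isCont[OF DERIV_G] by (simp add: isCont_def)
  then have lim: "(G b \<longlongrightarrow> G b (m b)) (at_left (m b))" "(G b \<longlongrightarrow> G b (m b)) (at_right (m b))"
    by (auto simp: filterlim_at_split)
  show "G b (m b) \<le> 0"
    by (rule tendsto_upperbound[OF lim(1)]) (simp_all add: eventually_at_filter less_imp_le[OF G_neg])
  show "0 \<le> G b (m b)"
    by (rule tendsto_lowerbound[OF lim(2)]) (simp_all add: eventually_at_filter less_imp_le[OF G_pos])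
qed

lemma G_eq_0_iff: "G b p = 0 \<longleftrightarrow> p = m b"
  using G_argmin[of b] G_neg[of p b] G_pos[of b p] by (cases p "m b" rule: linorder_cases) auto

lemma G_neg_iff: "G b p < 0 \<longleftrightarrow> p < m b" and G_pos_iff: "G b p > 0 \<longleftrightarrow> m b < p"
  using G_argmin[of b] G_neg[of p b] G_pos[of b p] by (cases p "m b" rule: linorder_cases; auto)+

lemma h_decreasing: "h b q < h b p" if "p < q" "q \<le> m b"
proof (rule DERIV_neg_imp_decreasing_open[OF that(1)])
  show "\<exists>y. (h b has_real_derivative y) (at x) \<and> y < 0" if "p < x" "x < q" for x
    using that \<open>q \<le> m b\<close> by (intro exI[of _ "G b x"] conjI DERIV_h G_neg) simp
qed (rule continuous_on_h)

lemma h_increasing: "h b p < h b q" if "p < q" "m b \<le> p"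
proof (rule DERIV_pos_imp_increasing_open[OF that(1)])
  show "\<exists>y. (h b has_real_derivative y) (at x) \<and> y > 0" if "p < x" "x < q" for x
    using that \<open>m b \<le> p\<close> by (intro exI[of _ "G b x"] conjI DERIV_h G_pos) simp
qed (rule continuous_on_h)

lemma h_argmin_less: "p \<noteq> m b \<Longrightarrow> h b (m b) < h b p"
  using h_decreasing[of p "m b" b] h_increasing[of "m b" p b] by linarith

lemma h_argmin_le: "h b (m b) \<le> h b p"
  using h_argmin_less[of p b] by (cases "p = m b") auto

text \<open>The infimum is attained at the minimizer, so the gap becomes a difference of fibre
  values to which Taylor's formula applies.\<close>

lemma gap_eq: "gap H E b = E - h b (m b)"
proof -
  have "fibre_inf H b = h b (m b)"
    unfolding fibre_inf_def
    by (rule cInf_eq_minimum) (auto simp: h_argmin_le)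
  then show ?thesis
    by (simp add: gap_def)
qed

text \<open>Coercivity raises the fibre to the level far out on both sides, the intermediate value
  theorem yields one root on each side of the minimizer, and strict monotonicity excludes further
  ones.\<close>

lemma two_roots:
  assumes "gap H E b > 0"
  obtains l r where "l < m b" "m b < r" "{p. h b p = E} = {l, r}"
proof -
  obtain R where R: "\<And>p. R \<le> \<bar>p\<bar> \<Longrightarrow> E \<le> h b p"
  proof -
    obtain U where "open U" "b \<in> U" and U: "\<And>M. \<exists>R. \<forall>b\<in>U. \<forall>p. R \<le> \<bar>p\<bar> \<longrightarrow> M \<le> h b p"
      using coercive unfolding coercive_def by blast
    then show thesis
      using U[of E] that by blast
  qed
  \<comment> \<open>\<open>S\<close> is large enough that the fibre is at least \<open>E\<close> at
    both \<open>S\<close> and \<open>- S\<close>, with the minimizer strictly in between.\<close>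
  define S where "S = \<bar>R\<bar> + \<bar>m b\<bar> + 1"
  have S: "R \<le> \<bar>S\<bar>" "R \<le> \<bar>- S\<bar>" "- S < m b" "m b < S"
    by (auto simp: S_def)
  have Em: "h b (m b) < E"
    using assms by (simp add: gap_eq)
  obtain l where l: "- S \<le> l" "l \<le> m b" "h b l = E"
    using IVT2'[of "h b" "m b" E "- S"] R[OF S(2)] S Em continuous_on_h by auto
  obtain r where r: "m b \<le> r" "r \<le> S" "h b r = E"
    using IVT'[of "h b" "m b" E S] R[OF S(1)] S Em continuous_on_h by auto
  have lr: "l < m b" "m b < r"
    using l r Em by (auto simp: less_le)
  moreover have "p = l \<or> p = r" if "h b p = E" for p
  proof (cases "p \<le> m b")
    case True
    then show ?thesis
      using h_decreasing[of p l b] h_decreasing[of l p b] l that by linarith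
  next
    case False
    then show ?thesis
      using h_increasing[of p r b] h_increasing[of r p b] r that by linarith
  qed
  ultimately show thesis
    using l(3) r(3) by (intro that[of l r]) auto
qed

lemma lifts:
  assumes "gap H E b > 0"
  shows "lift_minus H E b < m b" "m b < lift_plus H E b"
    "{p. h b p = E} = {lift_minus H E b, lift_plus H E b}"
proof -
  obtain l r where lr: "l < m b" "m b < r" "{p. h b p = E} = {l, r}"
    using two_roots[OF assms] .
  then have "lift_minus H E b = l" "lift_plus H E b = r"
    by (simp_all add: lift_minus_def lift_plus_def)
  with lr show "lift_minus H E b < m b" "m b < lift_plus H E b"
    "{p. h b p = E} = {lift_minus H E b, lift_plus H E b}"
    by simp_all
qed

text \<open>The level is attained, so the least value of the square is zero, and it is taken exactly
  at the roots.\<close>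

lemma residual_minimizers:
  assumes "gap H E b > 0"
  shows "{p. \<forall>x. residual H E b p \<le> residual H E b x} = {p. h b p = E}"
proof -
  obtain q where q: "h b q = E"
    using lifts(3)[OF assms] by blast
  have "h b p = E" if "\<And>x. residual H E b p \<le> residual H E b x" for p
    using that[of q] by (simp add: residual_def q)
  then show ?thesis
    by (auto simp: residual_def)
qed

text \<open>Besides the squared slope the product rule produces a term with the factor
  \<open>h b p - E\<close>, which vanishes at a root.\<close>

lemma residual_curvature:
  assumes "h b p = E"
  shows "deriv (deriv (residual H E b)) p = 2 * (G b p)\<^sup>2"
proof -
  have "(residual H E b has_real_derivative 2 * (h b x - E) * G b x) (at x)" for x
    unfolding residual_def by (auto intro!: derivative_eq_intros DERIV_h)
  then have "deriv (residual H E b) = (\<lambda>x. 2 * (h b x - E) * G b x)"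
    by (intro ext DERIV_imp_deriv)
  moreover have "((\<lambda>x. 2 * (h b x - E) * G b x) has_real_derivative 2 * (G b p)\<^sup>2) (at p)"
    by (auto intro!: derivative_eq_intros DERIV_h DERIV_G simp: assms power2_eq_square)
  ultimately show ?thesis
    by (simp add: DERIV_imp_deriv)
qed

text \<open>The sign of \<open>G b' a\<close> tells on which side of \<open>m b'\<close> a fixed
  \<open>a\<close> lies, and a nonzero sign at \<open>b\<close> persists nearby by
  continuity.\<close>

lemma tendsto_argmin: "(m \<longlongrightarrow> m b) (nhds b)"
proof (rule order_tendstoI)
  have lim: "((\<lambda>b'. G b' a) \<longlongrightarrow> G b a) (nhds b)" for a
    by (rule tendsto_case_prod_continuous[OF continuous_G]) (simp_all add: filterlim_ident)
  show "\<forall>\<^sub>F b' in nhds b. a < m b'" if "a < m b" for a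
    using order_tendstoD(2)[OF lim, of a 0] that by (simp add: G_neg_iff)
  show "\<forall>\<^sub>F b' in nhds b. m b' < a" if "m b < a" for a
    using order_tendstoD(1)[OF lim, of 0 a] that by (simp add: G_pos_iff)
qed

text \<open>Negative curvature would push the derivative below zero just to the right of the
  minimizer, where unimodality makes it positive.\<close>

lemma min_curvature_nonneg: "k b \<ge> 0"
proof (rule ccontr)
  assume "\<not> k b \<ge> 0"
  then have "K b (m b) < 0"
    by (simp add: min_curvature_def)
  from DERIV_neg_dec_right[OF DERIV_G this]
  obtain d where d: "d > 0" "\<And>t. 0 < t \<Longrightarrow> t < d \<Longrightarrow> G b (m b + t) < G b (m b)"
    by blast
  have "G b (m b + d / 2) < G b (m b)"
    using d(1) by (intro d(2)) auto
  moreover have "G b (m b + d / 2) > 0"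
    using d(1) by (intro G_pos) auto
  ultimately show False
    by (simp add: G_argmin)
qed

text \<open>The substitution \<open>p = m b + \<sigma> * t\<close> places either lift at a positive
  \<open>t\<close>, so the one-sided model serves both.\<close>

lemma lift_estimates:
  assumes gap: "gap H E b > 0" and "k b > 0" "0 \<le> w" "w \<le> k b / 2"
    and lift: "(\<sigma>, p) \<in> {(1, lift_plus H E b), (-1, lift_minus H E b)}"
    and near: "\<And>\<xi>. \<xi> \<in> closed_segment (m b) p \<Longrightarrow> \<bar>K b \<xi> - k b\<bar> \<le> w"
  shows "k b / 4 * (p - m b)\<^sup>2 \<le> gap H E b"
    and "gap H E b \<le> k b * (p - m b)\<^sup>2"
    and "\<bar>p - m b - \<sigma> * sqrt (2 * gap H E b / k b)\<bar> \<le> w * \<bar>p - m b\<bar> / k b"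
    and "\<bar>G b p - \<sigma> * sqrt (2 * k b * gap H E b)\<bar> \<le> 2 * w * \<bar>p - m b\<bar>"
    and "\<bar>2 * (G b p)\<^sup>2 - 4 * k b * gap H E b\<bar> \<le> 16 * k b * w * (p - m b)\<^sup>2"
proof -
  define x where "x = \<sigma> * (p - m b)"
  have \<sigma>: "\<sigma> = 1 \<or> \<sigma> = -1"
    using lift by auto
  \<comment> \<open>Differentiating twice through the reflection produces \<sigma> twice; the
    curvature is therefore unchanged.\<close>
  then have \<sigma>\<sigma>: "\<sigma> * (a * \<sigma>) = a" for a
    by auto
  have x: "x > 0" "x = \<bar>p - m b\<bar>" and hp: "h b p = E"
    using lift lifts[OF gap] by (auto simp: x_def)
  have p: "m b + \<sigma> * x = p"
    using \<sigma> by (auto simp: x_def)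
  define g where "g t = h b (m b + \<sigma> * t)" for t
  define g' where "g' t = \<sigma> * G b (m b + \<sigma> * t)" for t
  define g'' where "g'' t = K b (m b + \<sigma> * t)" for t
  have inner: "((\<lambda>t. m b + \<sigma> * t) has_real_derivative \<sigma>) (at t)" for t
    by (auto intro!: derivative_eq_intros)
  have "(g has_real_derivative g' t) (at t)" for t
    using DERIV_chain2[OF DERIV_h inner, of b t] unfolding g_def[abs_def] g'_def by (simp add: mult.commute)
  moreover have "(g' has_real_derivative g'' t) (at t)" for t
    using DERIV_cmult[OF DERIV_chain2[OF DERIV_G inner], of \<sigma> b t]
    unfolding g'_def[abs_def] g''_def \<sigma>\<sigma> .
  moreover have "g' 0 = 0"
    by (simp add: g'_def G_argmin)
  moreover have "g x - g 0 = gap H E b"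
    by (simp add: g_def p hp gap_eq)
  moreover have "\<bar>g'' t - k b\<bar> \<le> w" if "0 \<le> t" "t \<le> x" for t
    unfolding g''_def using \<sigma> that
    by (intro near) (auto simp: x_def closed_segment_eq_real_ivl)
  ultimately have *: "k b / 4 * x\<^sup>2 \<le> gap H E b" "gap H E b \<le> k b * x\<^sup>2"
    "\<bar>x - sqrt (2 * gap H E b / k b)\<bar> \<le> w * x / k b"
    "\<bar>g' x - sqrt (2 * k b * gap H E b)\<bar> \<le> 2 * w * x"
    "\<bar>2 * (g' x)\<^sup>2 - 4 * k b * gap H E b\<bar> \<le> 16 * k b * w * x\<^sup>2"
    using quadratic_level_estimates[OF x(1) assms(2-4), of g g' g'' "gap H E b"] by blast+
  have x2: "x\<^sup>2 = (p - m b)\<^sup>2"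
    by (simp add: x(2))
  show "k b / 4 * (p - m b)\<^sup>2 \<le> gap H E b" "gap H E b \<le> k b * (p - m b)\<^sup>2"
    using *(1,2) by (simp_all add: x2)
  \<comment> \<open>Undoing the reflection multiplies both errors by \<sigma>, which leaves their
    absolute values unchanged.\<close>
  have "p - m b - \<sigma> * s = \<sigma> * (x - s)" "G b p - \<sigma> * s = \<sigma> * (g' x - s)" for s
    using \<sigma> by (auto simp: x_def g'_def p)
  then show "\<bar>p - m b - \<sigma> * sqrt (2 * gap H E b / k b)\<bar> \<le> w * \<bar>p - m b\<bar> / k b"
    and "\<bar>G b p - \<sigma> * sqrt (2 * k b * gap H E b)\<bar> \<le> 2 * w * \<bar>p - m b\<bar>"
    using *(3,4) \<sigma> by (auto simp: abs_mult x(2))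
  have "(g' x)\<^sup>2 = (G b p)\<^sup>2"
    using \<sigma> by (auto simp: g'_def p)
  then show "\<bar>2 * (G b p)\<^sup>2 - 4 * k b * gap H E b\<bar> \<le> 16 * k b * w * (p - m b)\<^sup>2"
    using *(5) by (simp add: x2)
qed

end

section \<open>Convergence near a nondegenerate discriminant point\<close>

locale nondegenerate_discriminant_point = unimodal_fibres +
  fixes E\<^sub>0 :: real and b\<^sub>0 :: "real \<times> real"
  assumes discriminant: "b\<^sub>0 \<in> discriminant H E\<^sub>0" and nondegenerate: "nondegenerate_min H b\<^sub>0"
begin

abbreviation "F \<equiv> near_discriminant H E\<^sub>0 b\<^sub>0"

text \<open>A discriminant point has a critical point on the level, and the only critical point of a
  fibre is its minimizer.\<close>

lemma fibre_argmin_discriminant: "h b\<^sub>0 (m b\<^sub>0) = E\<^sub>0"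
proof -
  obtain p where p: "h b\<^sub>0 p = E\<^sub>0" "(h b\<^sub>0 has_real_derivative 0) (at p)"
    using discriminant by (auto simp: discriminant_def)
  then have "p = m b\<^sub>0"
    using G_eq_0_iff DERIV_imp_deriv by blast
  with p show ?thesis
    by simp
qed

lemma min_curvature_pos: "k b\<^sub>0 > 0"
  using nondegenerate min_curvature_nonneg[of b\<^sub>0] by (simp add: nondegenerate_min_def)

lemma tendsto_base: "(fst \<longlongrightarrow> E\<^sub>0) F" "(snd \<longlongrightarrow> b\<^sub>0) F"
  unfolding near_discriminant_def
  using tendsto_fst[OF tendsto_ident_at] tendsto_snd[OF tendsto_ident_at] by fastforce+

lemma eventually_snd: "eventually P (nhds b\<^sub>0) \<Longrightarrow> \<forall>\<^sub>F z in F. P (snd z)"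
  using tendsto_base(2) by (simp add: filterlim_iff)

lemma eventually_gap_pos: "\<forall>\<^sub>F (E, b) in F. gap H E b > 0"
  unfolding near_discriminant_def eventually_at_filter by (auto intro: always_eventually)

lemma tendsto_argmin_F: "((\<lambda>z. m (snd z)) \<longlongrightarrow> m b\<^sub>0) F"
  by (rule filterlim_compose[OF tendsto_argmin tendsto_base(2)])

lemma tendsto_h_argmin: "((\<lambda>b. h b (m b)) \<longlongrightarrow> E\<^sub>0) (nhds b\<^sub>0)"
  using tendsto_case_prod_continuous[OF continuous_h filterlim_ident tendsto_argmin[of b\<^sub>0]]
  by (simp add: fibre_argmin_discriminant)

lemma tendsto_min_curvature_nhds: "(k \<longlongrightarrow> k b\<^sub>0) (nhds b\<^sub>0)"
  using tendsto_case_prod_continuous[OF continuous_K filterlim_ident tendsto_argmin[of b\<^sub>0]]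
  by (simp add: min_curvature_def[abs_def])

lemma tendsto_min_curvature: "((\<lambda>(E, b). k b) \<longlongrightarrow> k b\<^sub>0) F"
  using filterlim_compose[OF tendsto_min_curvature_nhds tendsto_base(2)]
  by (simp add: case_prod_beta')

lemma tendsto_gap: "((\<lambda>(E, b). gap H E b) \<longlongrightarrow> 0) F"
  using tendsto_diff[OF tendsto_base(1) filterlim_compose[OF tendsto_h_argmin tendsto_base(2)]]
  by (simp add: gap_eq case_prod_beta')

text \<open>Rules out vacuous asymptotics: along the trivial filter every Landau statement holds.
  The approach keeps \<open>b\<^sub>0\<close> fixed and raises the level.\<close>

lemma near_discriminant_neq_bot: "F \<noteq> bot"
  unfolding near_discriminant_def trivial_limit_within not_not islimpt_approachable
proof (intro allI impI)
  fix e :: real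
  assume "e > 0"
  \<comment> \<open>Half of \<open>e\<close> keeps the pair within distance \<open>e\<close> and
    makes the gap at \<open>b\<^sub>0\<close> positive. By continuity the fibre minima stay below
    this level around \<open>b\<^sub>0\<close>, which makes \<open>b\<^sub>0\<close> an interior
    point.\<close>
  define E where "E = E\<^sub>0 + e / 2"
  have "\<forall>\<^sub>F b in nhds b\<^sub>0. h b (m b) < E"
    using \<open>e > 0\<close> by (intro order_tendstoD(2)[OF tendsto_h_argmin]) (simp add: E_def)
  then have "\<forall>\<^sub>F b in nhds b\<^sub>0. b \<in> admissible H E"
  proof eventually_elim
    case (elim b)
    then have "gap H E b > 0"
      by (simp add: gap_eq)
    from lifts(3)[OF this] show ?case
      by (auto simp: admissible_def)
  qed
  then have "b\<^sub>0 \<in> interior (admissible H E)"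
    by (auto simp: eventually_nhds interior_def)
  moreover have "gap H E b\<^sub>0 > 0"
    using \<open>e > 0\<close> by (simp add: gap_eq fibre_argmin_discriminant E_def)
  moreover have "(E, b\<^sub>0) \<noteq> (E\<^sub>0, b\<^sub>0)" "dist (E, b\<^sub>0) (E\<^sub>0, b\<^sub>0) < e"
    using \<open>e > 0\<close> by (simp_all add: E_def dist_Pair_Pair dist_real_def)
  ultimately show "\<exists>x'\<in>{(E, b). b \<in> interior (admissible H E) \<and> 0 < gap H E b}.
      x' \<noteq> (E\<^sub>0, b\<^sub>0) \<and> dist x' (E\<^sub>0, b\<^sub>0) < e"
    by (intro bexI[of _ "(E, b\<^sub>0)"]) auto
qed

text \<open>At \<open>b\<^sub>0\<close> the level is the strict fibre minimum, so any other
  \<open>a\<close> lies above it; continuity preserves this. Such an \<open>a\<close> acts as a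
  barrier for the lifts.\<close>

lemma eventually_level_below:
  assumes "a \<noteq> m b\<^sub>0"
  shows "\<forall>\<^sub>F (E, b) in F. E < h b a"
proof -
  have "((\<lambda>z. h (snd z) a - fst z) \<longlongrightarrow> h b\<^sub>0 a - E\<^sub>0) F"
    by (intro tendsto_diff tendsto_base tendsto_case_prod_continuous[OF continuous_h] tendsto_const)
  moreover have "h b\<^sub>0 a - E\<^sub>0 > 0"
    using h_argmin_less[OF assms] by (simp add: fibre_argmin_discriminant)
  ultimately show ?thesis
    using order_tendstoD(1)[of _ _ F 0] by (force simp: case_prod_beta')
qed

text \<open>Each lift is squeezed between the convergent minimizer and a barrier \<open>a\<close>:
  beyond \<open>a\<close> monotonicity keeps the fibre above the level.\<close>

lemma tendsto_lifts:
  shows tendsto_lift_plus: "((\<lambda>(E, b). lift_plus H E b) \<longlongrightarrow> m b\<^sub>0) F"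
    and tendsto_lift_minus: "((\<lambda>(E, b). lift_minus H E b) \<longlongrightarrow> m b\<^sub>0) F"
proof -
  have above: "\<forall>\<^sub>F (E, b) in F. lift_plus H E b < a" if "m b\<^sub>0 < a" for a
    using order_tendstoD(2)[OF tendsto_argmin_F that] eventually_gap_pos
      eventually_level_below[OF less_imp_neq[OF that, symmetric]]
  proof eventually_elim
    case (elim z)
    obtain E b where z: "z = (E, b)"
      by (cases z)
    with elim that have E: "m b < a" "gap H E b > 0" "E < h b a"
      by auto
    then have "h b (lift_plus H E b) = E"
      using lifts(3) by blast
    then show ?case
      using h_increasing[of a "lift_plus H E b" b] E z by (cases "lift_plus H E b" a rule: linorder_cases) auto
  qed
  have below: "\<forall>\<^sub>F (E, b) in F. a < lift_minus H E b" if "a < m b\<^sub>0" for a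
    using order_tendstoD(1)[OF tendsto_argmin_F that] eventually_gap_pos
      eventually_level_below[OF less_imp_neq[OF that]]
  proof eventually_elim
    case (elim z)
    obtain E b where z: "z = (E, b)"
      by (cases z)
    with elim that have E: "a < m b" "gap H E b > 0" "E < h b a"
      by auto
    then have "h b (lift_minus H E b) = E"
      using lifts(3) by blast
    then show ?case
      using h_decreasing[of "lift_minus H E b" a b] E z by (cases "lift_minus H E b" a rule: linorder_cases) auto
  qed
  have order: "\<forall>\<^sub>F (E, b) in F. lift_minus H E b < m b \<and> m b < lift_plus H E b"
    using eventually_gap_pos by eventually_elim (auto intro: lifts)
  show "((\<lambda>(E, b). lift_plus H E b) \<longlongrightarrow> m b\<^sub>0) F"
  proof (rule order_tendstoI)
    show "\<forall>\<^sub>F z in F. a < (case z of (E, b) \<Rightarrow> lift_plus H E b)" if "a < m b\<^sub>0" for a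
      using order_tendstoD(1)[OF tendsto_argmin_F that] order by eventually_elim auto
    show "\<forall>\<^sub>F z in F. (case z of (E, b) \<Rightarrow> lift_plus H E b) < a" if "m b\<^sub>0 < a" for a
      using above[OF that] by eventually_elim auto
  qed
  show "((\<lambda>(E, b). lift_minus H E b) \<longlongrightarrow> m b\<^sub>0) F"
  proof (rule order_tendstoI)
    show "\<forall>\<^sub>F z in F. a < (case z of (E, b) \<Rightarrow> lift_minus H E b)" if "a < m b\<^sub>0" for a
      using below[OF that] by eventually_elim auto
    show "\<forall>\<^sub>F z in F. (case z of (E, b) \<Rightarrow> lift_minus H E b) < a" if "m b\<^sub>0 < a" for a
      using order_tendstoD(2)[OF tendsto_argmin_F that] order by eventually_elim auto
  qed
qed

text \<open>Both lifts converge to \<open>m b\<^sub>0\<close> and balls on the line are intervals,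
  so a product neighbourhood eventually contains everything between them. This is the source of
  uniformity in \<open>(E, b)\<close>.\<close>

lemma eventually_between_lifts:
  assumes "\<forall>\<^sub>F (b, p) in nhds (b\<^sub>0, m b\<^sub>0). P b p"
  shows "\<forall>\<^sub>F (E, b) in F. \<forall>\<xi>\<in>{lift_minus H E b..lift_plus H E b}. P b \<xi>"
proof -
  obtain Q R where Q: "eventually Q (nhds b\<^sub>0)" and R: "eventually R (nhds (m b\<^sub>0))"
    and QR: "\<And>b p. Q b \<Longrightarrow> R p \<Longrightarrow> P b p"
    using assms by (auto simp: nhds_prod eventually_prod_filter)
  obtain e where e: "e > 0" "\<And>p. dist p (m b\<^sub>0) < e \<Longrightarrow> R p"
    using R by (auto simp: eventually_nhds_metric)
  have "\<forall>\<^sub>F z in F. dist (case z of (E, b) \<Rightarrow> lift_plus H E b) (m b\<^sub>0) < e"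
    "\<forall>\<^sub>F z in F. dist (case z of (E, b) \<Rightarrow> lift_minus H E b) (m b\<^sub>0) < e"
    using tendsto_lifts e(1) by (auto dest: tendstoD)
  with eventually_snd[OF Q] show ?thesis
    by eventually_elim (auto intro!: QR e(2) simp: dist_real_def)
qed

text \<open>\<open>K b p - k b\<close> tends to its value at
  \<open>(b\<^sub>0, m b\<^sub>0)\<close>, which is zero by the definition of
  \<open>k\<close>.\<close>

lemma eventually_curvature_close:
  assumes "w > 0"
  shows "\<forall>\<^sub>F (E, b) in F. \<forall>\<xi>\<in>{lift_minus H E b..lift_plus H E b}. \<bar>K b \<xi> - k b\<bar> \<le> w"
proof (rule eventually_between_lifts)
  have fst: "(fst \<longlongrightarrow> b\<^sub>0) (nhds (b\<^sub>0, m b\<^sub>0))" and snd: "(snd \<longlongrightarrow> m b\<^sub>0) (nhds (b\<^sub>0, m b\<^sub>0))"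
    using tendsto_fst[OF filterlim_ident] tendsto_snd[OF filterlim_ident] by fastforce+
  have "((\<lambda>z. K (fst z) (snd z) - k (fst z)) \<longlongrightarrow> K b\<^sub>0 (m b\<^sub>0) - k b\<^sub>0) (nhds (b\<^sub>0, m b\<^sub>0))"
    by (intro tendsto_diff tendsto_case_prod_continuous[OF continuous_K] fst snd
        filterlim_compose[OF tendsto_min_curvature_nhds])
  from tendstoD[OF this assms]
  show "\<forall>\<^sub>F (b, p) in nhds (b\<^sub>0, m b\<^sub>0). \<bar>K b p - k b\<bar> \<le> w"
    by eventually_elim (auto simp: dist_real_def min_curvature_def)
qed

lemma eventually_min_curvature_bounds: "\<forall>\<^sub>F (E, b) in F. k b\<^sub>0 / 2 < k b \<and> k b < 2 * k b\<^sub>0"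
  using order_tendstoD(1)[OF tendsto_min_curvature, of "k b\<^sub>0 / 2"]
    order_tendstoD(2)[OF tendsto_min_curvature, of "2 * k b\<^sub>0"] min_curvature_pos
  by (auto elim: eventually_elim2)

section \<open>Uniform error bounds and Landau estimates for the lifts\<close>

abbreviation "\<Delta> \<equiv> (\<lambda>(E, b). gap H E b)"
text \<open>The pair \<open>(\<sigma>, r)\<close> is either \<open>(1, lift_plus H)\<close> or
  \<open>(-1, lift_minus H)\<close>, so one proof covers both lifts. The curvature is quadratic in
  the slope and carries no sign.\<close>

abbreviation "separation_error \<sigma> r \<equiv>
  (\<lambda>(E, b). r E b - m b - \<sigma> * sqrt (2 * gap H E b / k b))"
abbreviation "slope_error \<sigma> r \<equiv>
  (\<lambda>(E, b). deriv (h b) (r E b) - \<sigma> * sqrt (2 * k b * gap H E b))"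
abbreviation "curvature_error r \<equiv>
  (\<lambda>(E, b). deriv (deriv (residual H E b)) (r E b) - 4 * k b * gap H E b)"

lemma segment_between_lifts:
  assumes "(\<sigma>, r) \<in> {(1, lift_plus H), (-1, lift_minus H)}" "gap H E b > 0"
  shows "closed_segment (m b) (r E b) \<subseteq> {lift_minus H E b..lift_plus H E b}"
  using assms(1) lifts(1,2)[OF assms(2)] by (auto simp: closed_segment_eq_real_ivl)

text \<open>
  The bound \<open>w\<close> is quantified inside the filter, so that it may depend on \<open>(E, b)\<close>: the Lipschitz
  case takes it proportional to the distance of the lift from the minimizer.
\<close>

lemma uniform_lift_estimates:
  assumes r: "(\<sigma>, r) \<in> {(1, lift_plus H), (-1, lift_minus H)}"
  obtains C where "C > 0"
    and "\<forall>\<^sub>F (E, b) in F. \<bar>r E b - m b\<bar> \<le> C * sqrt (gap H E b) \<and> sqrt (gap H E b) \<le> C * \<bar>r E b - m b\<bar>"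
    and "\<forall>\<^sub>F (E, b) in F. \<forall>w. 0 \<le> w \<longrightarrow> w \<le> k b\<^sub>0 / 4 \<longrightarrow>
      (\<forall>\<xi>\<in>closed_segment (m b) (r E b). \<bar>K b \<xi> - k b\<bar> \<le> w) \<longrightarrow>
      \<bar>separation_error \<sigma> r (E, b)\<bar> \<le> C * (w * sqrt (gap H E b)) \<and>
      \<bar>slope_error \<sigma> r (E, b)\<bar> \<le> C * (w * sqrt (gap H E b)) \<and>
      \<bar>curvature_error r (E, b)\<bar> \<le> C * (w * gap H E b)"
proof -
  \<comment> \<open>Freezing the curvature at \<open>b\<^sub>0\<close> makes the constants
    independent of \<open>(E, b)\<close>; eventually \<open>k b\<close> lies between half and twice
    this value.\<close>
  define \<kappa> where "\<kappa> = k b\<^sub>0"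
  have \<kappa>: "\<kappa> > 0"
    using min_curvature_pos by (simp add: \<kappa>_def)
  \<comment> \<open>\<open>A\<close> and \<open>B\<close> are read off from
    \<open>\<kappa> / 8 * x\<^sup>2 \<le> D\<close> and
    \<open>D \<le> 2 * \<kappa> * x\<^sup>2\<close> by taking roots; \<open>C\<close> dominates
    every coefficient that arises below.\<close>
  define A where "A = sqrt (8 / \<kappa>)"
  define B where "B = sqrt (2 * \<kappa>)"
  define C where "C = A + B + 2 * A / \<kappa> + 2 * A + 64"
  have AB: "A \<ge> 0" "B \<ge> 0" "2 * A / \<kappa> \<ge> 0"
    using \<kappa> by (simp_all add: A_def B_def)
  then have C: "C > 0" "A \<le> C" "B \<le> C" "2 * A / \<kappa> \<le> C" "2 * A \<le> C" "64 \<le> C"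
    by (simp_all add: C_def)
  \<comment> \<open>\<open>\<kappa> / 4\<close> is an admissible \<open>w\<close>, being below
    \<open>k b / 2\<close> once \<open>k b > \<kappa> / 2\<close>.\<close>
  have \<kappa>4: "\<kappa> / 4 > 0"
    using \<kappa> by simp
  have lift: "(\<sigma>, r E b) \<in> {(1, lift_plus H E b), (-1, lift_minus H E b)}" for E b
    using r by auto
  have bounds: "\<forall>\<^sub>F (E, b) in F. gap H E b > 0 \<and> \<kappa> / 2 < k b \<and> k b < 2 * \<kappa> \<and>
      \<bar>r E b - m b\<bar> \<le> A * sqrt (gap H E b) \<and> sqrt (gap H E b) \<le> B * \<bar>r E b - m b\<bar>"
    using eventually_gap_pos eventually_min_curvature_bounds eventually_curvature_close[OF \<kappa>4]
  proof eventually_elim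
    case (elim z)
    obtain E b where z: "z = (E, b)"
      by (cases z)
    define D where "D = gap H E b"
    define x where "x = r E b - m b"
    have D: "D > 0" and kb: "\<kappa> / 2 < k b" "k b < 2 * \<kappa>"
      and close: "\<And>\<xi>. \<xi> \<in> {lift_minus H E b..lift_plus H E b} \<Longrightarrow> \<bar>K b \<xi> - k b\<bar> \<le> \<kappa> / 4"
      using elim by (auto simp: z D_def \<kappa>_def)
    have "closed_segment (m b) (r E b) \<subseteq> {lift_minus H E b..lift_plus H E b}"
      using D by (intro segment_between_lifts[OF r]) (simp add: D_def)
    then have near: "\<bar>K b \<xi> - k b\<bar> \<le> \<kappa> / 4" if "\<xi> \<in> closed_segment (m b) (r E b)" for \<xi>
      using close that by blast
    have x2: "k b / 4 * x\<^sup>2 \<le> D" "D \<le> k b * x\<^sup>2"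
      unfolding D_def x_def
      using lift_estimates(1,2)[OF _ _ _ _ lift near] D kb \<kappa> by (auto simp: D_def)
    have "\<kappa> / 8 * x\<^sup>2 \<le> k b / 4 * x\<^sup>2" "k b * x\<^sup>2 \<le> 2 * \<kappa> * x\<^sup>2"
      using kb by (intro mult_right_mono; simp)+
    then have "\<kappa> / 8 * x\<^sup>2 \<le> D" and hi: "D \<le> 2 * \<kappa> * x\<^sup>2"
      using x2 by linarith+
    then have "x\<^sup>2 \<le> 8 / \<kappa> * D"
      using \<kappa> by (simp add: field_simps)
    then have "sqrt (x\<^sup>2) \<le> sqrt (8 / \<kappa> * D)" "sqrt D \<le> sqrt (2 * \<kappa> * x\<^sup>2)"
      using hi by (simp_all only: real_sqrt_le_iff)
    then have "\<bar>x\<bar> \<le> A * sqrt D" "sqrt D \<le> B * \<bar>x\<bar>"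
      unfolding A_def B_def by (simp_all only: real_sqrt_mult real_sqrt_abs)
    then show ?case
      using D kb by (simp add: z D_def x_def)
  qed
  show thesis
  proof (rule that[OF C(1)])
    show "\<forall>\<^sub>F (E, b) in F. \<bar>r E b - m b\<bar> \<le> C * sqrt (gap H E b) \<and> sqrt (gap H E b) \<le> C * \<bar>r E b - m b\<bar>"
      using bounds
    proof eventually_elim
      case (elim z)
      have "A * sqrt (\<Delta> z) \<le> C * sqrt (\<Delta> z)" "B * \<bar>y\<bar> \<le> C * \<bar>y\<bar>" for y
        using C elim by (auto intro!: mult_right_mono)
      with elim show ?case
        by (fastforce intro: order_trans)
    qed
    show "\<forall>\<^sub>F (E, b) in F. \<forall>w. 0 \<le> w \<longrightarrow> w \<le> k b\<^sub>0 / 4 \<longrightarrow>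
      (\<forall>\<xi>\<in>closed_segment (m b) (r E b). \<bar>K b \<xi> - k b\<bar> \<le> w) \<longrightarrow>
      \<bar>separation_error \<sigma> r (E, b)\<bar> \<le> C * (w * sqrt (gap H E b)) \<and>
      \<bar>slope_error \<sigma> r (E, b)\<bar> \<le> C * (w * sqrt (gap H E b)) \<and>
      \<bar>curvature_error r (E, b)\<bar> \<le> C * (w * gap H E b)"
      using bounds
    proof eventually_elim
      case (elim z)
      obtain E b where z: "z = (E, b)"
        by (cases z)
      define D where "D = gap H E b"
      define x where "x = r E b - m b"
      have gap: "gap H E b > 0" and kb: "\<kappa> / 2 < k b" "k b < 2 * \<kappa>"
        and x: "\<bar>x\<bar> \<le> A * sqrt D" and D: "D > 0"
        using elim by (simp_all add: z x_def D_def)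
      have "\<bar>separation_error \<sigma> r (E, b)\<bar> \<le> C * (w * sqrt (gap H E b)) \<and>
          \<bar>slope_error \<sigma> r (E, b)\<bar> \<le> C * (w * sqrt (gap H E b)) \<and>
          \<bar>curvature_error r (E, b)\<bar> \<le> C * (w * gap H E b)"
        if w: "0 \<le> w" "w \<le> k b\<^sub>0 / 4"
          and near: "\<forall>\<xi>\<in>closed_segment (m b) (r E b). \<bar>K b \<xi> - k b\<bar> \<le> w" for w
      proof -
        have kpos: "k b > 0" and whalf: "w \<le> k b / 2"
          using kb \<kappa> w by (simp_all add: \<kappa>_def)
        note est = lift_estimates[OF gap kpos w(1) whalf lift bspec[OF near], folded D_def x_def]
        have "h b (r E b) = E"
          using lift[of E b] lifts(3)[OF gap] by blast
        then have curv: "curvature_error r (E, b) = 2 * (G b (r E b))\<^sup>2 - 4 * k b * D"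
          by (simp add: residual_curvature D_def)
        have wx: "w * \<bar>x\<bar> \<le> w * (A * sqrt D)"
          using x w(1) by (rule mult_left_mono)
        have "w * \<bar>x\<bar> / k b \<le> w * (A * sqrt D) / (\<kappa> / 2)"
          using wx kb \<kappa> w(1) AB(1) D by (intro frac_le) auto
        also have "\<dots> = 2 * A / \<kappa> * (w * sqrt D)"
          using \<kappa> by (simp add: field_simps)
        also have "\<dots> \<le> C * (w * sqrt D)"
          using C(4) w(1) D by (intro mult_right_mono) auto
        finally have sep: "\<bar>separation_error \<sigma> r (E, b)\<bar> \<le> C * (w * sqrt D)"
          using est(3) by (simp add: D_def x_def)
        have "2 * w * \<bar>x\<bar> \<le> 2 * A * (w * sqrt D)"
          using wx by (simp add: mult_ac)
        also have "\<dots> \<le> C * (w * sqrt D)"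
          using C(5) w(1) D by (intro mult_right_mono) auto
        finally have slope: "\<bar>slope_error \<sigma> r (E, b)\<bar> \<le> C * (w * sqrt D)"
          using est(4) by (simp add: D_def)
        \<comment> \<open>This grouping exposes the quantity that \<open>D\<close> bounds, so
          \<open>k b\<close> disappears from the constant.\<close>
        have "16 * k b * w * x\<^sup>2 = 64 * w * (k b / 4 * x\<^sup>2)"
          by simp
        also have "\<dots> \<le> 64 * w * D"
          using est(1) w(1) by (intro mult_left_mono) auto
        also have "\<dots> \<le> C * (w * D)"
          using mult_right_mono[OF C(6), of "w * D"] w(1) D by (simp add: mult.assoc)
        finally have "\<bar>curvature_error r (E, b)\<bar> \<le> C * (w * D)"
          using est(5) unfolding curv by linarith
        with sep slope show ?thesis
          unfolding D_def by blast
      qed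
      then show ?case
        unfolding z prod.case by blast
    qed
  qed
qed

text \<open>Here \<open>w\<close> is a constant: continuity of the curvature makes every positive
  \<open>w\<close> eventually admissible, so the prefactor can be arbitrarily small.\<close>

lemma eventually_small_errors:
  assumes r: "(\<sigma>, r) \<in> {(1, lift_plus H), (-1, lift_minus H)}" and "c > 0"
  shows "\<forall>\<^sub>F z in F. \<bar>separation_error \<sigma> r z\<bar> \<le> c * sqrt (\<Delta> z) \<and>
    \<bar>slope_error \<sigma> r z\<bar> \<le> c * sqrt (\<Delta> z) \<and> \<bar>curvature_error r z\<bar> \<le> c * \<Delta> z"
proof -
  obtain C where C: "C > 0" and est: "\<forall>\<^sub>F (E, b) in F. \<forall>w. 0 \<le> w \<longrightarrow> w \<le> k b\<^sub>0 / 4 \<longrightarrow>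
      (\<forall>\<xi>\<in>closed_segment (m b) (r E b). \<bar>K b \<xi> - k b\<bar> \<le> w) \<longrightarrow>
      \<bar>separation_error \<sigma> r (E, b)\<bar> \<le> C * (w * sqrt (gap H E b)) \<and>
      \<bar>slope_error \<sigma> r (E, b)\<bar> \<le> C * (w * sqrt (gap H E b)) \<and>
      \<bar>curvature_error r (E, b)\<bar> \<le> C * (w * gap H E b)"
    using uniform_lift_estimates[OF r] by blast
  \<comment> \<open>The first entry brings \<open>C * w\<close> below \<open>c\<close>; the second
    is the ceiling imposed by the uniform estimate.\<close>
  define w where "w = min (c / C) (k b\<^sub>0 / 4)"
  have w: "w > 0" "w \<le> k b\<^sub>0 / 4" "C * w \<le> c"
  proof -
    show "w > 0"
      using C \<open>c > 0\<close> min_curvature_pos by (simp add: w_def)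
    show "w \<le> k b\<^sub>0 / 4"
      by (simp only: w_def min.cobounded2)
    have "C * w \<le> C * (c / C)"
      using C by (intro mult_left_mono) (simp_all add: w_def)
    then show "C * w \<le> c"
      using C by simp
  qed
  show ?thesis
    using est eventually_gap_pos eventually_curvature_close[OF w(1)]
  proof eventually_elim
    case (elim z)
    obtain E b where z: "z = (E, b)"
      by (cases z)
    have gap: "gap H E b > 0"
      using elim by (simp add: z)
    have "\<forall>\<xi>\<in>closed_segment (m b) (r E b). \<bar>K b \<xi> - k b\<bar> \<le> w"
      using elim segment_between_lifts[OF r gap] by (auto simp: z)
    then have "\<bar>separation_error \<sigma> r z\<bar> \<le> C * (w * sqrt (\<Delta> z))"
      "\<bar>slope_error \<sigma> r z\<bar> \<le> C * (w * sqrt (\<Delta> z))" "\<bar>curvature_error r z\<bar> \<le> C * (w * \<Delta> z)"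
      using elim(1) w(1,2) by (auto simp: z)
    moreover have "C * (w * sqrt (\<Delta> z)) \<le> c * sqrt (\<Delta> z)" "C * (w * \<Delta> z) \<le> c * \<Delta> z"
      using w(3) gap unfolding mult.assoc[symmetric] by (auto simp: z intro!: mult_right_mono)
    ultimately show ?case
      by linarith
  qed
qed

lemma small_errors:
  assumes r: "(\<sigma>, r) \<in> {(1, lift_plus H), (-1, lift_minus H)}"
  shows "separation_error \<sigma> r \<in> o[F](\<lambda>z. sqrt (\<Delta> z))"
    and "slope_error \<sigma> r \<in> o[F](\<lambda>z. sqrt (\<Delta> z))"
    and "curvature_error r \<in> o[F](\<Delta>)"
proof -
  have ev: "\<forall>\<^sub>F z in F. \<bar>separation_error \<sigma> r z\<bar> \<le> c * \<bar>sqrt (\<Delta> z)\<bar> \<and>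
    \<bar>slope_error \<sigma> r z\<bar> \<le> c * \<bar>sqrt (\<Delta> z)\<bar> \<and> \<bar>curvature_error r z\<bar> \<le> c * \<bar>\<Delta> z\<bar>" if "c > 0" for c
    using eventually_small_errors[OF r that] eventually_gap_pos
    by eventually_elim auto
  show "separation_error \<sigma> r \<in> o[F](\<lambda>z. sqrt (\<Delta> z))" "slope_error \<sigma> r \<in> o[F](\<lambda>z. sqrt (\<Delta> z))"
    "curvature_error r \<in> o[F](\<Delta>)"
    by (rule landau_o.smallI, rule eventually_mono[OF ev], assumption, simp)+
qed

text \<open>With \<open>w\<close> proportional to the distance of the lift from the minimizer,
  \<open>w\<close> is of order \<open>sqrt \<Delta>\<close>, and every error gains this factor over
  the little-o scale.\<close>

lemma lipschitz_errors:
  assumes r: "(\<sigma>, r) \<in> {(1, lift_plus H), (-1, lift_minus H)}" and "lipschitz_curvature H b\<^sub>0"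
  shows "separation_error \<sigma> r \<in> O[F](\<Delta>)"
    and "slope_error \<sigma> r \<in> O[F](\<Delta>)"
    and "curvature_error r \<in> O[F](\<lambda>z. \<Delta> z powr (3/2))"
proof -
  obtain L' where "\<forall>\<^sub>F (b, p) in nhds (b\<^sub>0, m b\<^sub>0). \<bar>K b p - k b\<bar> \<le> L' * \<bar>p - m b\<bar>"
    using assms(2) by (auto simp: lipschitz_curvature_def)
  note lip = eventually_between_lifts[OF this]
  \<comment> \<open>The given Lipschitz constant may be negative, whereas \<open>w\<close> must not
    be.\<close>
  define L where "L = \<bar>L'\<bar>"
  obtain C where C: "C > 0" and size: "\<forall>\<^sub>F (E, b) in F. \<bar>r E b - m b\<bar> \<le> C * sqrt (gap H E b) \<and>
        sqrt (gap H E b) \<le> C * \<bar>r E b - m b\<bar>"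
    and est: "\<forall>\<^sub>F (E, b) in F. \<forall>w. 0 \<le> w \<longrightarrow> w \<le> k b\<^sub>0 / 4 \<longrightarrow>
      (\<forall>\<xi>\<in>closed_segment (m b) (r E b). \<bar>K b \<xi> - k b\<bar> \<le> w) \<longrightarrow>
      \<bar>separation_error \<sigma> r (E, b)\<bar> \<le> C * (w * sqrt (gap H E b)) \<and>
      \<bar>slope_error \<sigma> r (E, b)\<bar> \<le> C * (w * sqrt (gap H E b)) \<and>
      \<bar>curvature_error r (E, b)\<bar> \<le> C * (w * gap H E b)"
    using uniform_lift_estimates[OF r] by blast
  have "((\<lambda>(E, b). r E b) \<longlongrightarrow> m b\<^sub>0) F"
    using r tendsto_lifts by auto
  \<comment> \<open>This is the future \<open>w\<close>; since it tends to zero it eventually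
    respects the ceiling \<open>k b\<^sub>0 / 4\<close>.\<close>
  then have "((\<lambda>z. L * \<bar>(case z of (E, b) \<Rightarrow> r E b) - m (snd z)\<bar>) \<longlongrightarrow> L * \<bar>m b\<^sub>0 - m b\<^sub>0\<bar>) F"
    by (intro tendsto_intros tendsto_argmin_F)
  then have small: "\<forall>\<^sub>F z in F. L * \<bar>(case z of (E, b) \<Rightarrow> r E b) - m (snd z)\<bar> < k b\<^sub>0 / 4"
    using min_curvature_pos by (intro order_tendstoD(2)) auto
  \<comment> \<open>The outer \<open>C\<close> comes from the error estimate, \<open>L * C\<close>
    from bounding \<open>w\<close> by a multiple of \<open>sqrt D\<close>.\<close>
  define M where "M = C * (L * C)"
  have ev: "\<forall>\<^sub>F z in F. \<bar>separation_error \<sigma> r z\<bar> \<le> M * \<Delta> z \<and>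
    \<bar>slope_error \<sigma> r z\<bar> \<le> M * \<Delta> z \<and> \<bar>curvature_error r z\<bar> \<le> M * \<Delta> z powr (3/2) \<and> \<Delta> z > 0"
    using est size small lip eventually_gap_pos
  proof eventually_elim
    case (elim z)
    obtain E b where z: "z = (E, b)"
      by (cases z)
    define D where "D = gap H E b"
    have D: "D > 0" and gap: "gap H E b > 0"
      using elim by (simp_all add: z D_def)
    define w where "w = L * \<bar>r E b - m b\<bar>"
    have w: "0 \<le> w" "w \<le> k b\<^sub>0 / 4"
      using elim by (simp_all add: z w_def L_def)
    have "\<bar>K b \<xi> - k b\<bar> \<le> w" if \<xi>: "\<xi> \<in> closed_segment (m b) (r E b)" for \<xi>
    proof -
      have "\<bar>K b \<xi> - k b\<bar> \<le> L' * \<bar>\<xi> - m b\<bar>"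
        using elim \<xi> segment_between_lifts[OF r gap] by (auto simp: z)
      \<comment> \<open>No point of the segment is farther from the minimizer than the lift.\<close>
      also have "\<dots> \<le> L * \<bar>r E b - m b\<bar>"
        using \<xi> unfolding L_def
        by (intro mult_mono) (auto simp: closed_segment_eq_real_ivl split: if_splits)
      finally show ?thesis
        by (simp add: w_def)
    qed
    then have err: "\<bar>separation_error \<sigma> r z\<bar> \<le> C * (w * sqrt D)"
      "\<bar>slope_error \<sigma> r z\<bar> \<le> C * (w * sqrt D)" "\<bar>curvature_error r z\<bar> \<le> C * (w * D)"
      using elim(1) w by (auto simp: z D_def)
    have "\<bar>r E b - m b\<bar> \<le> C * sqrt D"
      using elim(2) by (simp add: z D_def)
    then have "w \<le> L * (C * sqrt D)"
      unfolding w_def by (rule mult_left_mono) (simp add: L_def)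
    then have "C * (w * y) \<le> C * (L * (C * sqrt D) * y)" if "y \<ge> 0" for y
      using C that by (intro mult_left_mono mult_right_mono) auto
    from this[of "sqrt D"] this[of D]
    have "C * (w * sqrt D) \<le> C * (L * (C * sqrt D) * sqrt D)" "C * (w * D) \<le> C * (L * (C * sqrt D) * D)"
      using D by simp_all
    moreover have "L * (C * sqrt D) * sqrt D = L * C * D" "D powr (3/2) = D * sqrt D"
      using D powr_add[of D 1 "1/2"] by (simp_all add: powr_half_sqrt)
    ultimately have "C * (w * sqrt D) \<le> M * D" "C * (w * D) \<le> M * D powr (3/2)"
      unfolding M_def by (simp_all only: mult_ac)
    then have "\<bar>separation_error \<sigma> r z\<bar> \<le> M * D" "\<bar>slope_error \<sigma> r z\<bar> \<le> M * D"
      "\<bar>curvature_error r z\<bar> \<le> M * D powr (3/2)"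
      using err by (blast intro: order_trans)+
    then show ?case
      using gap by (simp add: z D_def)
  qed
  show "separation_error \<sigma> r \<in> O[F](\<Delta>)" "slope_error \<sigma> r \<in> O[F](\<Delta>)"
    "curvature_error r \<in> O[F](\<lambda>z. \<Delta> z powr (3/2))"
    by (rule bigoI[where c = M], rule eventually_mono[OF ev], simp)+
qed

section \<open>Exact orders of the residual curvature and the root separation\<close>

text \<open>Eventually the main term lies between 2 and 8 times
  \<open>k b\<^sub>0 * \<Delta> z\<close> and the error is at most one such unit, which gives the
  factors 1 and 9.\<close>

lemma residual_curvature_bigtheta:
  assumes r: "(\<sigma> :: real, r) \<in> {(1, lift_plus H), (-1, lift_minus H)}"
  shows "(\<lambda>(E, b). deriv (deriv (residual H E b)) (r E b)) \<in> \<Theta>[F](\<Delta>)"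
proof -
  let ?f = "\<lambda>(E, b). deriv (deriv (residual H E b)) (r E b)"
  have ev: "\<forall>\<^sub>F z in F. k b\<^sub>0 * \<Delta> z \<le> ?f z \<and> ?f z \<le> 9 * k b\<^sub>0 * \<Delta> z \<and> \<Delta> z > 0"
    using eventually_small_errors[OF r min_curvature_pos] eventually_gap_pos eventually_min_curvature_bounds
  proof eventually_elim
    case (elim z)
    obtain E b where z: "z = (E, b)"
      by (cases z)
    have gap: "gap H E b > 0"
      using elim by (simp add: z)
    have "\<bar>?f z - 4 * k b * gap H E b\<bar> \<le> k b\<^sub>0 * gap H E b"
      using elim by (simp add: z)
    moreover have "k b\<^sub>0 / 2 * gap H E b \<le> k b * gap H E b" "k b * gap H E b \<le> 2 * k b\<^sub>0 * gap H E b"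
      using elim by (auto simp: z intro!: mult_right_mono)
    ultimately have "k b\<^sub>0 * gap H E b \<le> ?f z" "?f z \<le> 9 * k b\<^sub>0 * gap H E b"
      using gap by linarith+
    with gap show ?case
      by (simp add: z)
  qed
  have "?f \<in> O[F](\<Delta>)"
    by (rule bigoI[where c = "9 * k b\<^sub>0"], rule eventually_mono[OF ev])
      (use min_curvature_pos mult_pos_pos[OF min_curvature_pos] in \<open>force simp: abs_if\<close>)
  moreover have "\<Delta> \<in> O[F](?f)"
    by (rule bigoI[where c = "1 / k b\<^sub>0"], rule eventually_mono[OF ev])
      (use min_curvature_pos in \<open>auto simp: field_simps abs_if\<close>)
  ultimately show ?thesis
    by (simp add: bigtheta_def bigomega_iff_bigo)
qed

text \<open>The minimizer lies between the lifts, so the separation is the sum of their distances to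
  it: the sum is bounded above, and the right-hand distance alone bounds it below.\<close>

lemma separation_bigtheta:
  "(\<lambda>(E, b). lift_plus H E b - lift_minus H E b) \<in> \<Theta>[F](\<lambda>z. sqrt (\<Delta> z))"
proof -
  let ?f = "\<lambda>(E, b). lift_plus H E b - lift_minus H E b"
  obtain C where C: "C > 0" "\<forall>\<^sub>F (E, b) in F. \<bar>lift_plus H E b - m b\<bar> \<le> C * sqrt (gap H E b) \<and>
        sqrt (gap H E b) \<le> C * \<bar>lift_plus H E b - m b\<bar>"
    using uniform_lift_estimates[of 1 "lift_plus H"] by blast
  obtain C' where C': "C' > 0" "\<forall>\<^sub>F (E, b) in F. \<bar>lift_minus H E b - m b\<bar> \<le> C' * sqrt (gap H E b) \<and>
        sqrt (gap H E b) \<le> C' * \<bar>lift_minus H E b - m b\<bar>"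
    using uniform_lift_estimates[of "-1" "lift_minus H"] by blast
  have ev: "\<forall>\<^sub>F z in F. \<bar>?f z\<bar> \<le> (C + C') * \<bar>sqrt (\<Delta> z)\<bar> \<and> \<bar>sqrt (\<Delta> z)\<bar> \<le> C * \<bar>?f z\<bar>"
    using C(2) C'(2) eventually_gap_pos
  proof eventually_elim
    case (elim z)
    obtain E b where z: "z = (E, b)"
      by (cases z)
    have gap: "gap H E b > 0"
      using elim by (simp add: z)
    have "C * \<bar>lift_plus H E b - m b\<bar> \<le> C * \<bar>lift_plus H E b - lift_minus H E b\<bar>"
      using C(1) lifts(1,2)[OF gap] by (intro mult_left_mono) auto
    then show ?case
      using elim gap lifts(1,2)[OF gap] by (auto simp: z distrib_right)
  qed
  have "?f \<in> O[F](\<lambda>z. sqrt (\<Delta> z))"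
    by (rule bigoI[where c = "C + C'"], rule eventually_mono[OF ev]) simp
  moreover have "(\<lambda>z. sqrt (\<Delta> z)) \<in> O[F](?f)"
    by (rule bigoI[where c = C], rule eventually_mono[OF ev]) simp
  ultimately show ?thesis
    by (simp add: bigtheta_def bigomega_iff_bigo)
qed

end

section \<open>Exact root identities combined with the asymptotic expansions\<close>

theorem corollary7p5:
  fixes H :: "real \<times> real \<times> real \<times> real \<Rightarrow> real" and E\<^sub>0 :: real and b\<^sub>0 :: "real \<times> real"
  assumes "C2 H"
    and "coercive H"
    and "unimodal H"
    and "b\<^sub>0 \<in> discriminant H E\<^sub>0"
    and "nondegenerate_min H b\<^sub>0"
  shows
   "(\<forall>E b. gap H E b > 0 \<longrightarrow>
       lift_minus H E b < lift_plus H E b \<and>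
       {p. fibre H b p = E} = {lift_minus H E b, lift_plus H E b} \<and>
       {p. \<forall>x. residual H E b p \<le> residual H E b x} = {lift_minus H E b, lift_plus H E b} \<and>
       deriv (deriv (residual H E b)) (lift_plus H E b)
         = 2 * (deriv (fibre H b) (lift_plus H E b))\<^sup>2 \<and>
       deriv (deriv (residual H E b)) (lift_minus H E b)
         = 2 * (deriv (fibre H b) (lift_minus H E b))\<^sup>2)
    \<and> (let F = near_discriminant H E\<^sub>0 b\<^sub>0;
           \<Delta> = (\<lambda>(E, b). gap H E b);
           sep_plus = (\<lambda>(E, b). lift_plus H E b - fibre_argmin H b
                         - sqrt (2 * gap H E b / min_curvature H b));
           sep_minus = (\<lambda>(E, b). lift_minus H E b - fibre_argmin H b
                         + sqrt (2 * gap H E b / min_curvature H b));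
           slope_plus = (\<lambda>(E, b). deriv (fibre H b) (lift_plus H E b)
                         - sqrt (2 * min_curvature H b * gap H E b));
           slope_minus = (\<lambda>(E, b). deriv (fibre H b) (lift_minus H E b)
                         + sqrt (2 * min_curvature H b * gap H E b));
           curv_plus = (\<lambda>(E, b). deriv (deriv (residual H E b)) (lift_plus H E b)
                         - 4 * min_curvature H b * gap H E b);
           curv_minus = (\<lambda>(E, b). deriv (deriv (residual H E b)) (lift_minus H E b)
                         - 4 * min_curvature H b * gap H E b)
       in F \<noteq> bot
        \<and> (\<Delta> \<longlongrightarrow> 0) F
        \<and> sep_plus \<in> o[F](\<lambda>x. sqrt (\<Delta> x)) \<and> sep_minus \<in> o[F](\<lambda>x. sqrt (\<Delta> x))
        \<and> slope_plus \<in> o[F](\<lambda>x. sqrt (\<Delta> x)) \<and> slope_minus \<in> o[F](\<lambda>x. sqrt (\<Delta> x))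
        \<and> curv_plus \<in> o[F](\<Delta>) \<and> curv_minus \<in> o[F](\<Delta>)
        \<and> (\<lambda>(E, b). lift_plus H E b - lift_minus H E b) \<in> \<Theta>[F](\<lambda>x. sqrt (\<Delta> x))
        \<and> (\<lambda>(E, b). deriv (deriv (residual H E b)) (lift_plus H E b)) \<in> \<Theta>[F](\<Delta>)
        \<and> (\<lambda>(E, b). deriv (deriv (residual H E b)) (lift_minus H E b)) \<in> \<Theta>[F](\<Delta>)
        \<and> (lipschitz_curvature H b\<^sub>0 \<longrightarrow>
              sep_plus \<in> O[F](\<Delta>) \<and> sep_minus \<in> O[F](\<Delta>)
            \<and> slope_plus \<in> O[F](\<Delta>) \<and> slope_minus \<in> O[F](\<Delta>)
            \<and> curv_plus \<in> O[F](\<lambda>x. \<Delta> x powr (3/2)) \<and> curv_minus \<in> O[F](\<lambda>x. \<Delta> x powr (3/2))))"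
proof -
  interpret nondegenerate_discriminant_point H E\<^sub>0 b\<^sub>0
    by unfold_locales (fact assms)+
  have plus: "(1, lift_plus H) \<in> {(1 :: real, lift_plus H), (-1, lift_minus H)}"
    and minus: "(-1, lift_minus H) \<in> {(1 :: real, lift_plus H), (-1, lift_minus H)}"
    by simp_all
  \<comment> \<open>Evaluates the sign \<sigma> at 1 and -1, so that subtracting \<open>-1\<close>
    times a root becomes the addition in the goal.\<close>
  note signs = mult_1_left mult_minus_left diff_minus_eq_add
  have roots: "lift_minus H E b < lift_plus H E b \<and>
       {p. fibre H b p = E} = {lift_minus H E b, lift_plus H E b} \<and>
       {p. \<forall>x. residual H E b p \<le> residual H E b x} = {lift_minus H E b, lift_plus H E b} \<and>
       deriv (deriv (residual H E b)) (lift_plus H E b)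
         = 2 * (deriv (fibre H b) (lift_plus H E b))\<^sup>2 \<and>
       deriv (deriv (residual H E b)) (lift_minus H E b)
         = 2 * (deriv (fibre H b) (lift_minus H E b))\<^sup>2" if gap: "gap H E b > 0" for E b
  proof -
    have "fibre H b (lift_plus H E b) = E" "fibre H b (lift_minus H E b) = E"
      using lifts(3)[OF gap] by blast+
    then show ?thesis
      using lifts[OF gap] residual_minimizers[OF gap] by (simp add: residual_curvature)
  qed
  show ?thesis
    unfolding Let_def
    by (rule conjI, use roots in blast, intro conjI impI)
      (fact near_discriminant_neq_bot tendsto_gap separation_bigtheta
        small_errors[OF plus, unfolded signs] small_errors[OF minus, unfolded signs]
        residual_curvature_bigtheta[OF plus] residual_curvature_bigtheta[OF minus]
      | erule lipschitz_errors[OF plus, unfolded signs] lipschitz_errors[OF minus, unfolded signs])+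
qed

end
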